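(* For every integer $n\geq 7$ there exists a simple finite graph $G$ of order $n$ (that is, with $n$ vertices) having exactly $$\binom{n}{2}-\left\lfloor\frac{n}{2}\right\rfloor-2$$ edges such that $G$ does not satisfy the Bakry--Émery curvature dimension condition $CD(0,\infty)$ with respect to the non-normalized graph Laplacian.
   Context: Let $G=(V,E)$ be a simple finite graph. The non-normalized Laplacian of $f:V\to\mathbb{R}$ is $\Delta f(x)=\sum_{y:\,xy\in E}(f(y)-f(x))$. For $f,g:V\to\mathbb{R}$ define $2\Gamma(f,g)=\Delta(fg)-f\Delta g-g\Delta f$ and $2\Gamma_2(f,g)=\Delta\Gamma(f,g)-\Gamma(f,\Delta g)-\Gamma(\Delta f,g)$, and write $\Gamma(f)=\Gamma(f,f)$, $\Gamma_2(f)=\Gamma_2(f,f)$. For $K\in\mathbb{R}$ and $N\in(0,\infty]$, a vertex $x\in V$ satisfies $CD(K,N,x)$ if for every $f:V\to\mathbb{R}$, $\Gamma_2(f)(x)\geq \frac1N(\Delta f(x))^2+K\,\Gamma(f)(x)$, with the convention $\frac1N=0$ when $N=\infty$. The graph $G$ satisfies $CD(K,N)$ if every vertex $x\in V$ satisfies $CD(K,N,x)$. In particular, $G$ satisfies $CD(0,\infty)$ if and only if $\Gamma_2(f)(x)\geq 0$ for all $f:V\to\mathbb{R}$ and all $x\in V$. *)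

theory Defs
  imports Complex_Main "HOL-Library.Extended_Nonnegative_Real"
begin

text \<open>Edges are two-element sets of vertices, so every undirected edge is counted once by
  \<open>card E\<close>, and loops and multiple edges are excluded.\<close>

locale simple_finite_graph =
  fixes V :: "'a set" and E :: "'a set set"
  assumes finite_vertices: "finite V"
    and edges: "\<And>e. e \<in> E \<Longrightarrow> e \<subseteq> V \<and> card e = 2"

text \<open>A function on \<open>V\<close> is represented by a total function on the vertex type. The operators
  below, evaluated at a vertex, only read its values on \<open>V\<close>, since neighbours of vertices
  are vertices.\<close>

definition laplacian :: "'a set set \<Rightarrow> ('a \<Rightarrow> real) \<Rightarrow> 'a \<Rightarrow> real" where
  "laplacian E f x = (\<Sum>y | {x, y} \<in> E. f y - f x)"

definition Gamma1 :: "'a set set \<Rightarrow> ('a \<Rightarrow> real) \<Rightarrow> ('a \<Rightarrow> real) \<Rightarrow> 'a \<Rightarrow> real" where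
  "Gamma1 E f g x =
     (laplacian E (\<lambda>z. f z * g z) x - f x * laplacian E g x - g x * laplacian E f x) / 2"

definition Gamma2 :: "'a set set \<Rightarrow> ('a \<Rightarrow> real) \<Rightarrow> ('a \<Rightarrow> real) \<Rightarrow> 'a \<Rightarrow> real" where
  "Gamma2 E f g x =
     (laplacian E (Gamma1 E f g) x - Gamma1 E f (laplacian E g) x
        - Gamma1 E (laplacian E f) g x) / 2"

text \<open>The dimension parameter \<open>N\<close> ranges over \<open>(0, \<infinity>]\<close>; in \<^typ>\<open>ennreal\<close> one has
  \<open>1 / \<infinity> = 0\<close>. The value \<open>N = 0\<close> is not meaningful.\<close>

definition CD_at :: "'a set set \<Rightarrow> real \<Rightarrow> ennreal \<Rightarrow> 'a \<Rightarrow> bool" where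
  "CD_at E K N x \<longleftrightarrow>
     (\<forall>f :: 'a \<Rightarrow> real.
        Gamma2 E f f x \<ge> enn2real (1 / N) * (laplacian E f x)\<^sup>2 + K * Gamma1 E f f x)"

definition CD :: "'a set \<Rightarrow> 'a set set \<Rightarrow> real \<Rightarrow> ennreal \<Rightarrow> bool" where
  "CD V E K N \<longleftrightarrow> (\<forall>x\<in>V. CD_at E K N x)"

end

theory Submission
  imports Defs
begin

text \<open>
  Curvature is negative at a vertex of small degree whose neighbours have many neighbours further
  away, since the spheres around it expand too fast. Suppose
  \<open>x\<close> has \<open>D\<close> neighbours, each of which has exactly \<open>m\<close> neighbours at distance two from \<open>x\<close>. For
  the distance function from \<open>x\<close>, edges between two neighbours of \<open>x\<close> contribute nothing, and
  one finds \<open>4 \<Gamma>\<^sub>2(f)(x) = D (D + 3 - m)\<close> (lemma \<open>Gamma2_dist2\<close>). So \<open>CD(0, \<infinity>)\<close> fails as soon as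
  \<open>D \<ge> 1\<close> and \<open>m > D + 3\<close>.

  A dense graph with this property arises by deleting from a complete graph on \<open>1 + D + m\<close>
  vertices the \<open>m\<close> edges of a star centred at \<open>0\<close>: then \<open>0\<close> keeps \<open>D\<close> neighbours, and each of them
  is still adjacent to all the \<open>m\<close> leaves of the star. With \<open>m = \<lfloor>n / 2\<rfloor> + 2\<close> and
  \<open>D = \<lceil>n / 2\<rceil> - 3\<close> there are \<open>n\<close> vertices, \<open>m - D\<close> is 4 or 5, and \<open>D \<ge> 1\<close> amounts to \<open>n \<ge> 7\<close>.
\<close>

lemma Gamma1_eq_sum:
  "Gamma1 E f g x = (\<Sum>y | {x, y} \<in> E. (f y - f x) * (g y - g x)) / 2"
proof -
  have "(\<Sum>y | {x, y} \<in> E. (f y - f x) * (g y - g x)) =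
        (\<Sum>y | {x, y} \<in> E. (f y * g y - f x * g x) - f x * (g y - g x) - g x * (f y - f x))"
    by (intro sum.cong) (auto simp: algebra_simps)
  then show ?thesis
    by (simp add: Gamma1_def laplacian_def sum_subtractf flip: sum_distrib_left)
qed

text \<open>The distance from \<open>x\<close>, truncated at two: \<open>\<Gamma>\<^sub>2\<close> at \<open>x\<close> only sees vertices up to that
  distance.\<close>

definition dist2 :: "'a set set \<Rightarrow> 'a \<Rightarrow> 'a \<Rightarrow> real" where
  "dist2 E x z = (if z = x then 0 else if {x, z} \<in> E then 1 else 2)"

text \<open>Around a neighbour \<open>y\<close> of \<open>x\<close> the increments of \<open>dist2 E x\<close> are \<open>-1\<close> once (towards \<open>x\<close>), \<open>1\<close>
  for each of the \<open>m\<close> outward edges, and \<open>0\<close> otherwise.\<close>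

lemma sum_dist2_increments:
  fixes h :: "real \<Rightarrow> real"
  assumes "{x, x} \<notin> E" and xy: "{x, y} \<in> E" and fin: "finite {z. {y, z} \<in> E}"
    and m: "card {z. {y, z} \<in> E \<and> z \<noteq> x \<and> {x, z} \<notin> E} = m" and "h 0 = 0"
  shows "(\<Sum>z | {y, z} \<in> E. h (dist2 E x z - dist2 E x y)) = h (- 1) + real m * h 1"
proof -
  let ?S = "{z. {y, z} \<in> E \<and> z \<noteq> x \<and> {x, z} \<notin> E}"
  have y: "dist2 E x y = 1" using assms(1) xy by (auto simp: dist2_def)
  have finS: "finite ?S" by (rule finite_subset[OF _ fin]) auto
  have "(\<Sum>z | {y, z} \<in> E. h (dist2 E x z - dist2 E x y)) =
        (\<Sum>z\<in>insert x ?S. h (dist2 E x z - dist2 E x y))"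
    by (rule sum.mono_neutral_right)
      (use fin xy y assms(5) in \<open>auto simp: dist2_def insert_commute\<close>)
  also have "\<dots> = h (- 1) + (\<Sum>z\<in>?S. h 1)"
    using finS y by (simp add: dist2_def)
  finally show ?thesis using m by simp
qed

text \<open>Here \<open>\<Delta>f\<close> equals \<open>D\<close> at \<open>x\<close> and \<open>m - 1\<close> at each neighbour, while \<open>2 \<Gamma>(f)\<close> equals \<open>D\<close> at
  \<open>x\<close> and \<open>m + 1\<close> at each neighbour. Hence
  \<open>4 \<Gamma>\<^sub>2(f)(x) = D (m + 1 - D) - 2 D (m - 1 - D)\<close>.\<close>

lemma Gamma2_dist2:
  assumes loop: "{x, x} \<notin> E"
    and fin: "\<And>y. {x, y} \<in> E \<Longrightarrow> finite {z. {y, z} \<in> E}"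
    and m: "\<And>y. {x, y} \<in> E \<Longrightarrow> card {z. {y, z} \<in> E \<and> z \<noteq> x \<and> {x, z} \<notin> E} = m"
    and D: "card {y. {x, y} \<in> E} = D"
  shows "4 * Gamma2 E (dist2 E x) (dist2 E x) x = real D * (real D + 3 - real m)"
proof -
  let ?f = "dist2 E x"
  have fx: "?f x = 0" by (simp add: dist2_def)
  have fy: "?f y = 1" if "{x, y} \<in> E" for y
    using that loop by (auto simp: dist2_def)
  have Lx: "laplacian E ?f x = D"
    by (simp add: laplacian_def fx fy D)
  have Ly: "laplacian E ?f y = real m - 1" if "{x, y} \<in> E" for y
    using sum_dist2_increments[OF loop that fin[OF that] m[OF that], of "\<lambda>t. t"]
    by (simp add: laplacian_def)
  have Gx: "Gamma1 E ?f ?f x = D / 2"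
    by (simp add: Gamma1_eq_sum fx fy D)
  have Gy: "Gamma1 E ?f ?f y = (real m + 1) / 2" if "{x, y} \<in> E" for y
    using sum_dist2_increments[OF loop that fin[OF that] m[OF that], of "\<lambda>t. t * t"]
    by (simp add: Gamma1_eq_sum)
  have LG: "laplacian E (Gamma1 E ?f ?f) x = D * ((real m + 1) / 2 - D / 2)"
    by (subst laplacian_def) (simp add: Gx Gy D)
  have GL: "Gamma1 E ?f (laplacian E ?f) x = D * (real m - 1 - D) / 2"
    by (simp add: Gamma1_eq_sum fx fy Lx Ly D)
  have LG': "Gamma1 E (laplacian E ?f) ?f x = D * (real m - 1 - D) / 2"
    by (simp add: Gamma1_eq_sum fx fy Lx Ly D)
  show ?thesis
    unfolding Gamma2_def LG GL LG' by (simp add: field_simps)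
qed

definition star_deleted :: "nat \<Rightarrow> nat \<Rightarrow> nat set set" where
  "star_deleted d m = {e. e \<subseteq> {0..d + m} \<and> card e = 2} - (\<lambda>y. {0, y}) ` {d + 1..d + m}"

lemma pair_in_star_deleted:
  "{a, b} \<in> star_deleted d m \<longleftrightarrow>
     a \<noteq> b \<and> a \<le> d + m \<and> b \<le> d + m \<and> (a = 0 \<longrightarrow> b \<le> d) \<and> (b = 0 \<longrightarrow> a \<le> d)"
  by (auto simp: star_deleted_def card_2_iff doubleton_eq_iff image_iff)

lemma simple_finite_graph_star_deleted: "simple_finite_graph {0..d + m} (star_deleted d m)"
  by unfold_locales (auto simp: star_deleted_def)

lemma card_star_deleted: "card (star_deleted d m) + m = (d + m + 1) choose 2"
proof -
  let ?P = "{e. e \<subseteq> {0..d + m} \<and> card e = 2}" and ?S = "(\<lambda>y::nat. {0, y}) ` {d + 1..d + m}"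
  have S: "?S \<subseteq> ?P" by auto
  have P: "card ?P = (d + m + 1) choose 2"
    using n_subsets[of "{0..d + m}" 2] by simp
  have "card ?S = m"
    by (subst card_image) (auto simp: inj_on_def doubleton_eq_iff)
  moreover have "finite ?P" by (rule finite_subset[of _ "Pow {0..d + m}"]) auto
  ultimately show ?thesis
    using card_mono[OF _ S] card_Diff_subset[OF finite_subset[OF S] S] P
    by (simp add: star_deleted_def)
qed

lemma not_CD_star_deleted:
  assumes "1 \<le> d" and "d + 3 < m"
  shows "\<not> CD {0..d + m} (star_deleted d m) 0 \<infinity>"
proof
  let ?E = "star_deleted d m"
  let ?f = "dist2 ?E 0"
  assume "CD {0..d + m} ?E 0 \<infinity>"
  then have "0 \<le> Gamma2 ?E ?f ?f 0"
    by (auto simp: CD_def CD_at_def)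
  moreover have "4 * Gamma2 ?E ?f ?f 0 = real d * (real d + 3 - real m)"
  proof (rule Gamma2_dist2)
    show "{0, 0} \<notin> ?E" using pair_in_star_deleted[of 0 0] by blast
    show "finite {z. {y, z} \<in> ?E}" for y
      by (rule finite_subset[of _ "{0..d + m}"]) (auto simp: pair_in_star_deleted)
    show "card {z. {y, z} \<in> ?E \<and> z \<noteq> 0 \<and> {0, z} \<notin> ?E} = m" if "{0, y} \<in> ?E" for y
    proof -
      have "{z. {y, z} \<in> ?E \<and> z \<noteq> 0 \<and> {0, z} \<notin> ?E} = {d + 1..d + m}"
        using that by (auto simp: pair_in_star_deleted)
      then show ?thesis by simp
    qed
    have "{y. {0, y} \<in> ?E} = {1..d}" by (auto simp: pair_in_star_deleted)
    then show "card {y. {0, y} \<in> ?E} = d" by simp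
  qed
  moreover have "real d * (real d + 3 - real m) < 0"
    using assms by (intro mult_pos_neg) auto
  ultimately show False by linarith
qed

theorem mainTheorem2:
  fixes n :: nat
  assumes "n \<ge> 7"
  shows "\<exists>(V :: nat set) E.
           simple_finite_graph V E \<and> card V = n \<and>
           int (card E) = int (n choose 2) - \<lfloor>real n / 2\<rfloor> - 2 \<and>
           \<not> CD V E 0 \<infinity>"
proof -
  define m where "m = n div 2 + 2"
  define d where "d = n - 1 - m"
  have n: "d + m + 1 = n" and d: "1 \<le> d" and m: "d + 3 < m"
    using assms by (auto simp: m_def d_def)
  have "\<lfloor>real n / 2\<rfloor> = int (n div 2)"
    using floor_divide_of_nat_eq[of n 2] by simp
  then have "int (card (star_deleted d m)) = int (n choose 2) - \<lfloor>real n / 2\<rfloor> - 2"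
    using card_star_deleted[of d m] n by (simp add: m_def)
  moreover have "card {0..d + m} = n" using n by simp
  ultimately show ?thesis
    using simple_finite_graph_star_deleted not_CD_star_deleted[OF d m] by blast
qed

end
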